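(* Let $p\ge 3$ be a prime. There is no non-trivial CA-polynomial $f\in\mathbb{C}[X]$ of degree $N=p+1$ all of whose roots are rational numbers.
   Context: A polynomial $f\in\mathbb{C}[X]$ of degree $N\ge 1$ is called a CA-polynomial if for each $i=1,\dots,N-1$ the polynomials $f$ and $f^{(i)}$ (the $i$-th derivative) have a common complex root. A polynomial is called non-trivial if it has at least two distinct roots in $\mathbb{C}$. *)

theory Defs
  imports Complex_Main
    "HOL-Computational_Algebra.Computational_Algebra"
begin

definition CA_polynomial :: "complex poly \<Rightarrow> bool" where
  "CA_polynomial f \<longleftrightarrow>
     degree f \<ge> 1 \<and>
     (\<forall>i\<in>{1..degree f - 1}. \<exists>z. poly f z = 0 \<and> poly ((pderiv ^^ i) f) z = 0)"

definition nontrivial_polynomial :: "complex poly \<Rightarrow> bool" where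
  "nontrivial_polynomial f \<longleftrightarrow> (\<exists>z w. z \<noteq> w \<and> poly f z = 0 \<and> poly f w = 0)"

end

theory Submission
  imports Defs "HOL-Number_Theory.Residues"
begin

text \<open>
  Translate so that the common root of \<open>f\<close> and the \<open>p\<close>-th derivative is \<open>0\<close>; then the roots sum to
  \<open>0\<close>. Scale so that the roots are integers, not all divisible by \<open>p\<close>, and let \<open>g\<close> be the monic
  polynomial with these roots. Descending induction on \<open>i\<close> from \<open>p\<close> to \<open>2\<close>, using a common root of
  \<open>g\<close> and its \<open>i\<close>-th derivative, shows that \<open>p\<close> divides the coefficient of \<open>X\<^sup>i\<close>. Hence
  \<open>g \<equiv> X\<^bsup>p+1\<^esup> - c X\<close> modulo \<open>p\<close> for some \<open>c\<close>, and by Fermat every root is \<open>0\<close> or \<open>c\<close> modulo \<open>p\<close>.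
  As the roots sum to \<open>0\<close>, exactly one of them (namely \<open>0\<close>) is divisible by \<open>p\<close>, and the other \<open>p\<close>
  are congruent to \<open>c\<close>. Summing \<open>(x - c)\<^sup>2\<close> over these shows that the sum of the squares of the roots
  is \<open>- p c\<^sup>2\<close> modulo \<open>p\<^sup>2\<close>. On the other hand the derivative of order \<open>p - 1\<close> is, up to a factor,
  \<open>p (p + 1) X\<^sup>2\<close> minus that sum, so a common root \<open>r\<close> of it and \<open>g\<close> satisfies
  \<open>r\<^sup>2 \<equiv> - c\<^sup>2\<close> modulo \<open>p\<close>, contradicting that \<open>r\<close> is \<open>0\<close> or \<open>c\<close> modulo \<open>p\<close> with \<open>p\<close> odd.
\<close>

hide_const (open) UnivPoly.coeff Module.smult

section \<open>Higher derivatives of polynomials\<close>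

lemma poly_higher_pderiv_altdef:
  fixes f :: "'a :: {comm_semiring_1,semiring_no_zero_divisors} poly"
  assumes "degree f \<le> m + i"
  shows "poly ((pderiv ^^ i) f) x = (\<Sum>n\<le>m. pochhammer (of_nat (Suc n)) i * coeff f (n + i) * x ^ n)"
proof -
  have "poly ((pderiv ^^ i) f) x = (\<Sum>n\<le>m. coeff ((pderiv ^^ i) f) n * x ^ n)"
  proof -
    have "degree ((pderiv ^^ i) f) \<le> m"
      using assms by (intro degree_le) (auto simp: coeff_higher_pderiv coeff_eq_0)
    then show ?thesis
      unfolding poly_altdef by (intro sum.mono_neutral_left) (auto simp: coeff_eq_0)
  qed
  then show ?thesis
    by (simp only: coeff_higher_pderiv)
qed

text \<open>Each application of the chain rule contributes one factor \<open>s\<close>. This carries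
  common roots through an affine change of variable.\<close>

lemma higher_pderiv_pcompose_linear:
  fixes f :: "'a :: idom poly"
  shows "(pderiv ^^ i) (pcompose f [:b, s:]) = smult (s ^ i) (pcompose ((pderiv ^^ i) f) [:b, s:])"
  by (induction i) (simp_all add: pderiv_smult pderiv_pcompose pderiv_pCons mult.commute)

lemma higher_pderiv_of_int_poly:
  "(pderiv ^^ i) (map_poly of_int f) = (map_poly of_int ((pderiv ^^ i) f) :: complex poly)"
proof (induction i)
  case (Suc i)
  then show ?case
    by (auto intro!: poly_eqI simp: coeff_pderiv coeff_map_poly)
qed simp

lemma poly_of_int_poly_of_int:
  "poly (map_poly of_int f) (of_int x) = (of_int (poly f x) :: complex)"
  by (induction f) (simp_all add: map_poly_pCons)

section \<open>Coefficients of products of linear factors\<close>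

lemma of_int_poly_prod_linear:
  "map_poly of_int (\<Prod>x\<in>#M. [:-x, 1:]) = (\<Prod>x\<in>#M. [:- of_int x, 1:] :: complex poly)"
proof (induction M)
  case (add a M)
  have "map_poly of_int ([:-a, 1:] * f) = [:- of_int a, 1:] * (map_poly of_int f :: complex poly)" for f
    by (intro poly_eqI) (auto simp: coeff_map_poly coeff_pCons split: nat.splits)
  with add show ?case by simp
qed simp

lemma degree_prod_mset_linear:
  "degree (\<Prod>x\<in>#M. [:-x, 1 :: 'a :: idom:]) = size M"
proof (induction M)
  case (add a M)
  have "(\<Prod>x\<in>#M. [:-x, 1 :: 'a:]) \<noteq> 0" by auto
  with add show ?case by (simp add: degree_mult_eq del: mult_pCons_left)
qed simp

lemma coeff_size_prod_mset_linear:
  "coeff (\<Prod>x\<in>#M. [:-x, 1 :: 'a :: idom:]) (size M) = 1"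
proof -
  have "lead_coeff (\<Prod>x\<in>#M. [:-x, 1 :: 'a:]) = 1"
    by (induction M) (simp_all add: lead_coeff_mult del: mult_pCons_left)
  then show ?thesis by (simp add: degree_prod_mset_linear)
qed

text \<open>Prepending zeros to the coefficient list avoids truncated subtraction in the indices
  \<open>size M - 1\<close> and \<open>size M - 2\<close>.\<close>
lemma coeff_prod_mset_linear_1:
  "coeff (pCons 0 (\<Prod>x\<in>#M. [:-x, 1 :: 'a :: idom:])) (size M) = - \<Sum>\<^sub># M"
proof (induction M)
  case (add a M)
  then show ?case
    by (simp add: coeff_size_prod_mset_linear)
qed simp

text \<open>The coefficient two below the top is the second elementary symmetric function; the
  factor 2 avoids division.\<close>

lemma coeff_prod_mset_linear_2:
  "2 * coeff (pCons 0 (pCons 0 (\<Prod>x\<in>#M. [:-x, 1 :: 'a :: idom:]))) (size M) =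
    (\<Sum>\<^sub># M)\<^sup>2 - (\<Sum>x\<in>#M. x\<^sup>2)"
proof (induction M)
  case (add a M)
  have step: "coeff (pCons 0 (pCons 0 ([:-a, 1:] * h))) (Suc n) =
      coeff (pCons 0 (pCons 0 h)) n - a * coeff (pCons 0 h) n" for h :: "'a poly" and n
    by (cases n) simp_all
  show ?case
    unfolding image_mset_add_mset prod_mset.add_mset size_add_mset step
    using add coeff_prod_mset_linear_1[of M] by (simp add: algebra_simps power2_eq_square)
qed simp

section \<open>Congruences\<close>

lemma fermat_little_int:
  assumes "prime p"
  shows "[x ^ p = x] (mod int p)"
proof -
  define a where "a = nat (x mod int p)"
  have p: "p > 0" using assms by (simp add: prime_gt_0_nat)
  have "[a ^ p = a] (mod p)"
  proof (cases "p dvd a")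
    case True
    then show ?thesis using p
      by (metis cong_0_iff cong_sym cong_trans dvd_power dvd_trans)
  next
    case False
    then have "[a * a ^ (p - 1) = a * 1] (mod p)"
      using assms by (intro cong_scalar_left fermat_theorem)
    then show ?thesis using p by (simp flip: power_Suc)
  qed
  then have "[int a ^ p = int a] (mod int p)"
    by (metis cong_int_iff of_nat_power)
  moreover have "[int a = x] (mod int p)"
    using p by (simp add: a_def)
  ultimately show ?thesis
    by (meson cong_pow cong_sym cong_trans)
qed

lemma sum_mset_cong_const:
  assumes "\<And>x. x \<in># M \<Longrightarrow> [f x = c] (mod (m :: int))"
  shows "[(\<Sum>x\<in>#M. f x) = int (size M) * c] (mod m)"
  using assms by (induction M) (auto simp: algebra_simps intro!: cong_add)

section \<open>The arithmetic core for integer roots\<close>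

text \<open>The conclusion is meant to clash with a scaling in which some root is not a multiple of
  \<open>p\<close>.\<close>

lemma int_roots_divisible:
  fixes M :: "int multiset"
  defines "g \<equiv> \<Prod>x\<in>#M. [:-x, 1:]"
  assumes p: "prime p" "p \<ge> 3" and M: "size M = p + 1" "0 \<in># M"
    and mean: "poly ((pderiv ^^ p) g) 0 = 0"
    and CA: "\<And>i. i \<in> {2..p-1} \<Longrightarrow> \<exists>x\<in>#M. poly ((pderiv ^^ i) g) x = 0"
  shows "\<forall>x\<in>#M. int p dvd x"
proof (rule ccontr)
  assume nd: "\<not> ?thesis"
  have prime: "prime (int p)" using p by simp
  have deg: "degree g = p + 1"
    using M by (simp add: g_def degree_prod_mset_linear)
  have lead: "coeff g (p + 1) = 1"
    using M coeff_size_prod_mset_linear[of M] by (simp add: g_def)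
  have "coeff ((pderiv ^^ p) g) 0 = 0"
    using mean by (simp only: poly_0_coeff_0)
  then have cp: "coeff g p = 0"
    by (simp add: coeff_higher_pderiv pochhammer_fact [symmetric])
  have sum0: "\<Sum>\<^sub># M = 0"
    using coeff_prod_mset_linear_1[of M] M cp by (simp add: g_def)
  have root: "poly g x = 0" if "x \<in># M" for x
    using that by (auto simp: g_def poly_prod_mset)
  have c0: "coeff g 0 = 0"
    using root[OF M(2)] by (simp add: poly_0_coeff_0)
  have dvd: "int p dvd coeff g i" if "i \<in> {2..p}" for i
    using that
  proof (induction "p - i" arbitrary: i rule: less_induct)
    case less
    show ?case
    proof (cases "i = p")
      case True
      then show ?thesis using cp by simp
    next
      case False
      with less.prems have i: "2 \<le> i" "i < p" by auto
      have "i \<in> {2..p - 1}" using i by auto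
      then obtain x where "poly ((pderiv ^^ i) g) x = 0"
        using CA by blast
      moreover have "degree g \<le> (p + 1 - i) + i" using deg i by simp
      ultimately have "0 = (\<Sum>n\<le>p + 1 - i. pochhammer (int (Suc n)) i * coeff g (n + i) * x ^ n)"
        by (simp only: poly_higher_pderiv_altdef)
      \<comment> \<open>The term n = 0 is i! times the coefficient sought, and i! is prime to
        \<open>p\<close> since i < p. So it suffices that \<open>p\<close> divides all other
        terms.\<close>
      also have "{..p + 1 - i} = insert 0 {1..p + 1 - i}" by auto
      finally have *: "0 = pochhammer 1 i * coeff g i +
          (\<Sum>n\<in>{1..p + 1 - i}. pochhammer (int (Suc n)) i * coeff g (n + i) * x ^ n)"
        by simp
      have "int p dvd pochhammer (int (Suc n)) i * coeff g (n + i) * x ^ n"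
        if n: "n \<in> {1..p + 1 - i}" for n
      proof (cases "n = p + 1 - i")
        case True
        \<comment> \<open>Here the coefficient is the leading 1, so \<open>p\<close> must come from
          the product (p+2-i)...(p+1), which contains \<open>p\<close> because i >= 2.\<close>
        have "int p = int (Suc n) + int (i - 2)" using True i by simp
        moreover have "int (Suc n) + int (i - 2) dvd (\<Prod>j\<in>{0..<i}. int (Suc n) + int j)"
          using i by (intro dvd_prodI) auto
        ultimately have "int p dvd pochhammer (int (Suc n)) i"
          by (simp only: pochhammer_prod)
        then show ?thesis by simp
      next
        case False
        then have "int p dvd coeff g (n + i)"
          using n i by (intro less.hyps) auto
        then show ?thesis by simp
      qed
      then have "int p dvd (\<Sum>n\<in>{1..p + 1 - i}. pochhammer (int (Suc n)) i * coeff g (n + i) * x ^ n)"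
        by (rule dvd_sum)
      moreover have "pochhammer 1 i * coeff g i =
          - (\<Sum>n\<in>{1..p + 1 - i}. pochhammer (int (Suc n)) i * coeff g (n + i) * x ^ n)"
        using * by linarith
      ultimately have "int p dvd pochhammer 1 i * coeff g i"
        by (simp only: dvd_minus_iff)
      moreover have "\<not> int p dvd pochhammer 1 i"
      proof -
        have "\<not> int p dvd int (fact i)"
          using i p prime_dvd_fact_iff[of p i] by (simp only: of_nat_dvd_iff)
        then show ?thesis by (metis pochhammer_fact of_nat_fact)
      qed
      ultimately show ?thesis using prime by (simp add: prime_dvd_mult_iff)
    qed
  qed
  define c where "c = - coeff g 1"
  have modp: "int p dvd x \<or> [x = c] (mod int p)" if "x \<in># M" for x
  proof -
    have "0 = (\<Sum>n\<le>p + 1. coeff g n * x ^ n)"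
      using root[OF that] deg by (simp add: poly_altdef)
    also have "{..p + 1} = insert 1 (insert (p + 1) (insert 0 {2..p}))"
      using p by auto
    finally have "0 = - c * x + (x ^ (p + 1) + (\<Sum>n\<in>{2..p}. coeff g n * x ^ n))"
      using p by (simp add: c0 lead[simplified] c_def)
    moreover have "int p dvd (\<Sum>n\<in>{2..p}. coeff g n * x ^ n)"
      by (intro dvd_sum dvd_mult2 dvd)
    moreover from calculation(1)
    have "x ^ (p + 1) - c * x = - (\<Sum>n\<in>{2..p}. coeff g n * x ^ n)"
      by simp
    ultimately have "int p dvd x ^ (p + 1) - c * x"
      by (simp only: dvd_minus_iff)
    moreover have "int p dvd x * (x ^ p - x)"
      using fermat_little_int[OF p(1), of x] by (simp add: cong_iff_dvd_diff)
    ultimately have "int p dvd (x ^ (p + 1) - c * x) - x * (x ^ p - x)"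
      by (rule dvd_diff)
    also have "(x ^ (p + 1) - c * x) - x * (x ^ p - x) = x * (x - c)"
      by (simp add: algebra_simps)
    finally show ?thesis
      using prime by (simp add: prime_dvd_mult_iff cong_iff_dvd_diff)
  qed
  \<comment> \<open>If \<open>p\<close> divided \<open>c\<close>, both alternatives in
    \<open>modp\<close> would make every root a multiple of \<open>p\<close>.\<close>
  have pc: "\<not> int p dvd c"
    using nd modp cong_dvd_iff by blast
  \<comment> \<open>Only one copy of 0 is removed; any further multiples of \<open>p\<close> are
    collected in \<open>A\<close>, which turns out empty because \<open>p\<close> divides the
    positive number \<open>size B\<close>, itself at most \<open>p\<close>.\<close>
  define M' where "M' = M - {#0#}"
  have M': "M = add_mset 0 M'" "size M' = p" using M by (auto simp: M'_def size_Diff_singleton)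
  have sum0': "\<Sum>\<^sub># M' = 0" using sum0 M' by simp
  define A B where "A = filter_mset (\<lambda>x. int p dvd x) M'" and "B = filter_mset (\<lambda>x. \<not> int p dvd x) M'"
  have AB: "M' = A + B" by (simp add: A_def B_def)
  have "[\<Sum>\<^sub># A = int (size A) * 0] (mod int p)"
    using sum_mset_cong_const[of A "\<lambda>x. x" 0 "int p"] by (auto simp: A_def cong_0_iff)
  moreover have "[\<Sum>\<^sub># B = int (size B) * c] (mod int p)"
    using sum_mset_cong_const[of B "\<lambda>x. x" c "int p"] modp M' by (auto simp: B_def)
  ultimately have "[\<Sum>\<^sub># A + \<Sum>\<^sub># B = int (size A) * 0 + int (size B) * c] (mod int p)"
    by (rule cong_add)
  then have "int p dvd int (size B) * c"
    using sum0' AB by (simp add: cong_0_iff cong_sym_eq[of 0])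
  then have "p dvd size B"
    using pc prime by (simp add: prime_dvd_mult_iff)
  moreover have "B \<noteq> {#}"
  proof -
    obtain x where "x \<in># M" "\<not> int p dvd x" using nd by blast
    then have "x \<in># B" using M' by (auto simp: B_def)
    then show ?thesis by auto
  qed
  ultimately have le: "p \<le> size B"
    by (intro dvd_imp_le) (auto simp flip: nonempty_has_size)
  have "size M' = size A + size B" by (simp add: AB)
  with M'(2) le have "size A = 0" by linarith
  then have "M' = B" using AB by simp
  then have cong_c: "[x = c] (mod int p)" if "x \<in># M'" for x
  proof -
    have "x \<in># B" using that \<open>M' = B\<close> by metis
    then have "\<not> int p dvd x" by (simp add: B_def)
    then show ?thesis using modp[of x] M'(1) that by simp
  qed
  have "p - 1 \<in> {2..p - 1}" using p by auto
  then obtain r where r: "r \<in># M" "poly ((pderiv ^^ (p - 1)) g) r = 0"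
    using CA by blast
  have c2: "2 * coeff g (p - 1) = - (\<Sum>x\<in>#M. x\<^sup>2)"
  proof -
    have "coeff (pCons 0 (pCons 0 g)) (p + 1) = coeff g (p - 1)"
      using p by (cases p) simp_all
    with coeff_prod_mset_linear_2[of M] M sum0 show ?thesis by (simp add: g_def)
  qed
  \<comment> \<open>The symbol is 3 * 4 * ... * (p+1) = (p+1)!/2.\<close>
  have f3: "2 * pochhammer 3 (p - 1) = int p * (int p + 1) * fact (p - 1)"
  proof -
    have "2 * pochhammer 3 (p - 1) = (fact (Suc (Suc (p - 1))) :: int)"
      using pochhammer_product'[of "1 :: int" 2 "p - 1"]
      by (simp add: pochhammer_fact pochhammer_Suc numeral_2_eq_2)
    also have "\<dots> = int p * (int p + 1) * fact (p - 1)"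
      using p by (simp add: algebra_simps fact_reduce[of p])
    finally show ?thesis .
  qed
  have "degree g \<le> 2 + (p - 1)" using deg p by simp
  then have "0 = (\<Sum>n\<le>2. pochhammer (int (Suc n)) (p - 1) * coeff g (n + (p - 1)) * r ^ n)"
    using r(2) by (simp only: poly_higher_pderiv_altdef)
  \<comment> \<open>The linear term drops out by \<open>cp\<close>.\<close>
  also have "\<dots> = fact (p - 1) * coeff g (p - 1) + pochhammer 3 (p - 1) * r\<^sup>2"
    using p cp lead by (simp add: numeral_2_eq_2 pochhammer_fact [symmetric])
  finally have "0 = 2 * (fact (p - 1) * coeff g (p - 1) + pochhammer 3 (p - 1) * r\<^sup>2)"
    by simp
  also have "\<dots> = fact (p - 1) * (2 * coeff g (p - 1)) + 2 * pochhammer 3 (p - 1) * r\<^sup>2"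
    by (simp add: algebra_simps)
  also have "\<dots> = fact (p - 1) * (int p * (int p + 1) * r\<^sup>2 - (\<Sum>x\<in>#M. x\<^sup>2))"
    unfolding c2 f3 by (simp add: algebra_simps)
  finally have sq: "(\<Sum>x\<in>#M. x\<^sup>2) = int p * (int p + 1) * r\<^sup>2" by simp
  \<comment> \<open>The modulus \<open>p\<^sup>2\<close> matters: the sum equals \<open>p\<close>
    times an integer, and one factor \<open>p\<close> must survive the cancellation.\<close>
  have "(int p)\<^sup>2 dvd (\<Sum>x\<in>#M'. (x - c)\<^sup>2)"
    using sum_mset_cong_const[of M' "\<lambda>x. (x - c)\<^sup>2" 0 "(int p)\<^sup>2"] cong_c
    by (auto simp: cong_0_iff cong_iff_dvd_diff)
  also have "(\<Sum>x\<in>#N. (x - c)\<^sup>2) = (\<Sum>x\<in>#N. x\<^sup>2) - 2 * c * \<Sum>\<^sub># N + int (size N) * c\<^sup>2" for N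
    by (induction N) (simp_all add: algebra_simps power2_eq_square)
  also have "(\<Sum>x\<in>#M'. x\<^sup>2) - 2 * c * \<Sum>\<^sub># M' + int (size M') * c\<^sup>2 = int p * ((int p + 1) * r\<^sup>2 + c\<^sup>2)"
    using sq M' sum0' by (simp add: algebra_simps)
  finally have "int p dvd (int p + 1) * r\<^sup>2 + c\<^sup>2"
    using p by (simp add: power2_eq_square)
  then have "int p dvd int p * r\<^sup>2 + (r\<^sup>2 + c\<^sup>2)"
    by (simp add: algebra_simps)
  then have rc: "int p dvd r\<^sup>2 + c\<^sup>2"
    by (simp only: dvd_add_right_iff dvd_triv_left)
  from modp[OF r(1)] have "int p dvd c\<^sup>2 \<or> int p dvd 2 * c\<^sup>2"
  proof
    assume "int p dvd r"
    then have "int p dvd r\<^sup>2" by (simp add: power2_eq_square)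
    with rc show ?thesis by (simp add: dvd_add_right_iff)
  next
    assume "[r = c] (mod int p)"
    then have "[r\<^sup>2 + c\<^sup>2 = c\<^sup>2 + c\<^sup>2] (mod int p)"
      by (intro cong_add cong_pow) auto
    with rc show ?thesis by (metis cong_dvd_iff mult_2)
  qed
  moreover have "\<not> int p dvd 2"
    using p by (auto dest: zdvd_imp_le)
  ultimately show False
    using pc prime by (simp add: prime_dvd_mult_iff prime_dvd_power_iff)
qed

section \<open>Reduction from rational to integer roots\<close>

text \<open>Clearing denominators gives integers, not all 0; dividing them by their gcd leaves
  integers with no common prime factor.\<close>

lemma Rats_scale_to_coprime_Ints:
  fixes S :: "complex set"
  assumes "finite S" "S \<subseteq> \<rat>" "\<not> S \<subseteq> {0}" "prime p"
  obtains s :: complex and n where "s \<noteq> 0" "\<And>z. z \<in> S \<Longrightarrow> s * z = of_int (n z)"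
    "\<exists>z\<in>S. \<not> int p dvd n z"
proof -
  have "\<exists>d :: int. d \<noteq> 0 \<and> (\<forall>z\<in>S. of_int d * z \<in> \<int>)"
    using assms(1,2)
  proof (induction S)
    case (insert q S)
    then obtain d :: int where d: "d \<noteq> 0" "\<forall>z\<in>S. of_int d * z \<in> \<int>" by auto
    from insert.prems obtain a b where q: "q = of_int a / of_int b" "b \<noteq> 0"
      by (auto elim: Rats_cases')
    have "of_int (b * d) * z \<in> \<int>" if "z \<in> S" for z
      using d that by (simp add: mult.assoc)
    moreover have "of_int (b * d) * q = of_int (d * a)"
      using q by simp
    then have "of_int (b * d) * q \<in> \<int>" by (metis Ints_of_int)
    ultimately show ?case using d q by (intro exI[of _ "b * d"]) auto
  qed (auto intro: exI[of _ 1])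
  then obtain d :: int where d: "d \<noteq> 0" "\<forall>z\<in>S. of_int d * z \<in> \<int>" by blast
  then have "\<forall>z\<in>S. \<exists>k. of_int d * z = of_int k" by (auto elim: Ints_cases)
  then obtain k where k: "\<And>z. z \<in> S \<Longrightarrow> of_int d * z = of_int (k z)" by metis
  define G where "G = Gcd (k ` S)"
  obtain w where w: "w \<in> S" "w \<noteq> 0" using assms by blast
  have "k w \<noteq> 0" using k[OF w(1)] w d by auto
  then have G: "G \<noteq> 0" using w by (auto simp: G_def)
  have G_dvd: "G dvd k z" if "z \<in> S" for z using that by (auto simp: G_def)
  show thesis
  proof (rule that)
    show "of_int d / of_int G \<noteq> (0 :: complex)" using d G by simp
    show "of_int d / of_int G * z = of_int (k z div G)" if "z \<in> S" for z
      using k[OF that] G_dvd[OF that] G by (auto simp: field_simps)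
    show "\<exists>z\<in>S. \<not> int p dvd k z div G"
    proof (rule ccontr)
      assume "\<not> ?thesis"
      then have "G * int p dvd k z" if "z \<in> S" for z
        using that G_dvd[OF that] G by (auto simp: dvd_div_iff_mult mult.commute)
      then have "G * int p dvd Gcd (k ` S)" by (auto intro: Gcd_greatest)
      then have "G * int p dvd G" by (simp only: G_def)
      then show False using G assms(4) by (auto simp: dvd_mult_cancel_left)
    qed
  qed
qed

theorem proposition8:
  fixes p :: nat
  assumes "prime p" and "p \<ge> 3"
  shows "\<not> (\<exists>f :: complex poly. CA_polynomial f \<and> nontrivial_polynomial f \<and>
            degree f = p + 1 \<and> (\<forall>z. poly f z = 0 \<longrightarrow> z \<in> \<rat>))"
proof (rule notI, elim exE conjE)
  fix f :: "complex poly"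
  assume CA: "CA_polynomial f" and nt: "nontrivial_polynomial f"
    and deg: "degree f = p + 1" and rat: "\<forall>z. poly f z = 0 \<longrightarrow> z \<in> \<rat>"
  have f0: "f \<noteq> 0" using deg by auto
  have CA': "\<exists>z. poly f z = 0 \<and> poly ((pderiv ^^ i) f) z = 0" if "i \<in> {1..p}" for i
    using CA deg that by (auto simp: CA_polynomial_def)
  \<comment> \<open>The derivative of order \<open>p\<close> is linear, and its zero is the mean of
    the roots.\<close>
  obtain z0 where z0: "poly f z0 = 0" "poly ((pderiv ^^ p) f) z0 = 0"
    using CA'[of p] assms by auto
  define S where "S = (\<lambda>z. z - z0) ` {z. poly f z = 0}"
  have "\<not> S \<subseteq> {0}"
    using nt unfolding S_def nontrivial_polynomial_def
    by (metis (mono_tags, lifting) eq_iff_diff_eq_0 image_subset_iff mem_Collect_eq singletonD)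
  moreover have "finite S" "S \<subseteq> \<rat>"
    using rat z0 f0 by (auto simp: S_def poly_roots_finite)
  ultimately obtain s n where s: "s \<noteq> 0" and n: "\<And>z. z \<in> S \<Longrightarrow> s * z = of_int (n z)"
    and ndvd: "\<exists>z\<in>S. \<not> int p dvd n z"
    using Rats_scale_to_coprime_Ints assms(1) by metis
  define k where "k z = n (z - z0)" for z
  have k: "of_int (k z) = s * (z - z0)" if "poly f z = 0" for z
    using n[of "z - z0"] that by (auto simp: S_def k_def)
  define M where "M = image_mset k (proots f)"
  define g where "g = (\<Prod>x\<in>#M. [:-x, 1:])"
  define Q :: "complex poly" where "Q = map_poly of_int g"
  \<comment> \<open>The inner polynomial is s(X - z0), which sends each root z of \<open>f\<close>
    to \<open>k z\<close>; hence \<open>f\<close> and the composition agree up to nonzero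
    constants.\<close>
  have Q: "smult (lead_coeff f) (pcompose Q [:- s * z0, s:]) = smult (s ^ size (proots f)) f"
  proof -
    have "pcompose (\<Prod>x\<in>#N. [:- of_int (k x), 1:]) [:- s * z0, s:] =
        smult (s ^ size N) (\<Prod>x\<in>#N. [:-x, 1:])" if "set_mset N \<subseteq> {z. poly f z = 0}" for N
      using that
    proof (induction N)
      case (add a N)
      have "pcompose [:- of_int (k a), 1:] [:- s * z0, s:] = smult s [:-a, 1:]"
        using add.prems k[of a] by (simp add: pcompose_pCons algebra_simps)
      with add show ?case by (simp add: pcompose_mult power_commutes
            del: mult_pCons_left mult_pCons_right smult_pCons)
    qed (simp add: pcompose_1)
    from this[of "proots f"] f0
    have "pcompose Q [:- s * z0, s:] =
        smult (s ^ size (proots f)) (\<Prod>x\<in>#proots f. [:-x, 1:])"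
      unfolding Q_def g_def M_def of_int_poly_prod_linear by (simp add: multiset.map_comp o_def)
    then have "smult (lead_coeff f) (pcompose Q [:- s * z0, s:]) =
        smult (s ^ size (proots f)) (smult (lead_coeff f) (\<Prod>x\<in>#proots f. [:-x, 1:]))"
      by (simp only: smult_smult mult.commute)
    then show ?thesis
      by (simp only: complex_poly_decompose_multiset)
  qed
  have eq: "smult (s ^ size (proots f)) ((pderiv ^^ i) f) =
      smult (lead_coeff f * s ^ i) (pcompose ((pderiv ^^ i) Q) [:- s * z0, s:])" for i
    using arg_cong[OF Q, of "pderiv ^^ i"]
    by (simp only: higher_pderiv_smult higher_pderiv_pcompose_linear smult_smult)
  have transfer: "poly ((pderiv ^^ i) g) (k z) = 0"
    if "poly f z = 0" "poly ((pderiv ^^ i) f) z = 0" for i z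
  proof -
    have "poly (smult (lead_coeff f * s ^ i) (pcompose ((pderiv ^^ i) Q) [:- s * z0, s:])) z = 0"
      using that by (subst eq [symmetric]) simp
    then have "poly ((pderiv ^^ i) Q) (of_int (k z)) = 0"
      using f0 s by (simp add: poly_pcompose k[OF that(1)] algebra_simps)
    then show ?thesis
      by (simp add: Q_def higher_pderiv_of_int_poly poly_of_int_poly_of_int)
  qed
  have k0: "k z0 = 0" using k[OF z0(1)] by simp
  have kM: "k z \<in># M" if "poly f z = 0" for z
    using that f0 by (auto simp: M_def)
  have "\<forall>x\<in>#M. int p dvd x"
  proof (rule int_roots_divisible[OF assms])
    show "size M = p + 1" using deg by (simp add: M_def size_proots_complex)
    show "0 \<in># M" using kM[OF z0(1)] k0 by simp
    show "poly ((pderiv ^^ p) (\<Prod>x\<in>#M. [:-x, 1:])) 0 = 0"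
      using transfer[OF z0] k0 by (simp add: g_def)
    show "\<exists>x\<in>#M. poly ((pderiv ^^ i) (\<Prod>x\<in>#M. [:-x, 1:])) x = 0" if i: "i \<in> {2..p - 1}" for i
    proof -
      have "i \<in> {1..p}" using i by auto
      then obtain z where "poly f z = 0" "poly ((pderiv ^^ i) f) z = 0"
        using CA' by blast
      then show ?thesis using transfer kM unfolding g_def by blast
    qed
  qed
  \<comment> \<open>The scaling was chosen so that some \<open>k z\<close> is not a multiple of
    \<open>p\<close>.\<close>
  then show False
    using ndvd kM by (auto simp: S_def k_def)
qed

end
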